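(* The following three statements hold. (1) For every $n\in\mathbb{N}$, $$c_{1,3,1}(8n-4)\equiv 0\pmod 7.$$ (2) For every pair of positive integers $a$ and $n$, $$c_{3a,4,2}(3n-1)\equiv 0\pmod 3\quad\text{and}\quad c_{3a-1,4,2}(3n-1)\equiv 0\pmod 3.$$ (3) For every $n\in\mathbb{Z}$ and every odd prime $p$, $$c_{1,2p-1,p-1}(p^2n+1)\equiv 0\pmod p\quad\text{and}\quad c_{1,2p-1,p}(p^2n+1)\equiv 0\pmod p.$$
   Context: $\mathbb{N}$ denotes the positive integers. For $a,k,r\in\mathbb{N}$, the integers $c_{a,k,r}(n)$ ($n\ge 1$) are the coefficients of the following formal power series in $q$, where the sum runs over integers $n_1,\dots,n_a$: $$\sum_{n\ge 1}c_{a,k,r}(n)q^n=\sum_{1\le n_1<\cdots<n_a}\frac{q^{r(n_1+\cdots+n_a)}}{(1-q^{n_1})^k\cdots(1-q^{n_a})^k}.$$ By convention $c_{a,k,r}(n)=0$ for integers $n\le 0$. *)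

theory Defs
  imports "HOL-Analysis.Infinite_Sum" "HOL-Number_Theory.Cong"
begin

unbundle fps_syntax

text \<open>
  Integer power series carry no \<^const>\<open>inverse\<close> operation, because \<^typ>\<open>int\<close> has none.
  So the reciprocal of a series with constant term 1 is written as \<^term>\<open>fps_right_inverse f 1\<close>.
\<close>

definition one_minus_X_power_inverse :: "nat \<Rightarrow> int fps" where
  "one_minus_X_power_inverse m = fps_right_inverse (1 - fps_X ^ m) 1"

definition increasing_tuples :: "nat \<Rightarrow> nat list set" where
  "increasing_tuples a = {ns. length ns = a \<and> sorted_wrt (<) ns \<and> (\<forall>m\<in>set ns. 1 \<le> m)}"

definition summand :: "nat \<Rightarrow> nat \<Rightarrow> nat list \<Rightarrow> int fps" where
  "summand k r ns =
     fps_X ^ (r * sum_list ns) * prod_list (map (\<lambda>m. one_minus_X_power_inverse m ^ k) ns)"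

text \<open>The infinite sum is taken in the \<open>X\<close>-adic topology; it converges for \<open>r \<ge> 1\<close>
  (\<open>summable_summand\<close> below).\<close>

definition gen_series :: "nat \<Rightarrow> nat \<Rightarrow> nat \<Rightarrow> int fps" where
  "gen_series a k r = (\<Sum>\<^sub>\<infinity>ns\<in>increasing_tuples a. summand k r ns)"

definition c_coeff :: "nat \<Rightarrow> nat \<Rightarrow> nat \<Rightarrow> int \<Rightarrow> int" where
  "c_coeff a k r n = (if n \<le> 0 then 0 else gen_series a k r $ nat n)"

lemma one_minus_X_power_inverse:
  assumes "m \<ge> 1"
  shows "(1 - fps_X ^ m) * one_minus_X_power_inverse m = 1"
  unfolding one_minus_X_power_inverse_def
  by (rule fps_right_inverse) (use assms in simp)

lemma finite_tuples_bounded: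
  "finite {ns \<in> increasing_tuples a. sum_list ns \<le> N}"
proof (rule finite_subset)
  show "{ns \<in> increasing_tuples a. sum_list ns \<le> N} \<subseteq> {ns. set ns \<subseteq> {..N} \<and> length ns = a}"
    unfolding increasing_tuples_def using member_le_sum_list order_trans by fastforce
  show "finite {ns. set ns \<subseteq> {..N} \<and> length ns = a}"
    by (rule finite_lists_length_eq) simp
qed

lemma summable_summand:
  assumes "r \<ge> 1"
  shows "summand k r summable_on increasing_tuples a"
proof -
  have fin: "finite {ns \<in> increasing_tuples a. summand k r ns $ n \<noteq> 0}" for n
  proof (rule finite_subset[OF _ finite_tuples_bounded[of a n]], safe)
    fix ns assume "summand k r ns $ n \<noteq> 0"
    then have "r * sum_list ns \<le> n"
      unfolding summand_def by (auto simp: fps_X_power_mult_nth not_less split: if_splits)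
    moreover have "sum_list ns \<le> r * sum_list ns"
      using assms by simp
    ultimately show "sum_list ns \<le> n" by linarith
  qed
  have "(summand k r has_sum Abs_fps (\<lambda>n. \<Sum>ns | ns \<in> increasing_tuples a \<and>
      summand k r ns $ n \<noteq> 0. summand k r ns $ n)) (increasing_tuples a)"
    by (rule has_sum_fpsI) (use fin in simp_all)
  then show ?thesis
    by (auto simp: summable_on_def)
qed

end

theory Submission
  imports Defs "HOL-Computational_Algebra.Polynomial"
begin

text \<open>
  For \<open>a = 1\<close>, expanding \<open>(1 - q\<^sup>m)\<^sup>-\<^sup>k\<close> gives \<open>c(n) = \<Sum> (d - r + k - 1 choose k - 1)\<close>, the sum running
  over the divisors \<open>d \<ge> r\<close> of \<open>n\<close>. In (1) the divisors of \<open>4m\<close>, \<open>m\<close> odd, are \<open>d, 2d, 4d\<close> with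
  \<open>d\<close> dividing \<open>m\<close>, and each such triple contributes a multiple of \<open>7\<close>. In (3) Lucas' congruence leaves
  only the divisors \<open>d \<equiv> -1\<close> (for \<open>r = p - 1\<close>) or \<open>d \<equiv> 1\<close> (for \<open>r = p\<close>) modulo \<open>p\<close>, and the
  terms of \<open>d\<close> and its complementary divisor cancel modulo \<open>p\<close>.

  For (2), put \<open>z = - w\<^sup>2\<close>. Then \<open>\<Sum>\<^sub>a z\<^sup>a \<Sum>\<^sub>n c(n) q\<^sup>n\<close> is \<open>F(w) F(-w)\<close> with
  \<open>F(w) = \<Prod> (1 - (2 - w) q\<^sup>i + q\<^sup>2\<^sup>i) / (1 - q\<^sup>i)\<^sup>2\<close>. By the Jacobi triple product,
  \<open>F(w) \<Prod> (1 - q\<^sup>i)\<^sup>3\<close> is the sum of \<open>(-1)\<^sup>n q\<^bsup>n(n+1)/2\<^esup> P\<^sub>n(2 - w)\<close>, where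
  \<open>P\<^sub>n(\<zeta> + \<zeta>\<^sup>-\<^sup>1) = \<zeta>\<^sup>-\<^sup>n + \<dots> + \<zeta>\<^sup>n\<close>. Modulo \<open>3\<close> the product \<open>\<Prod> (1 - q\<^sup>i)\<^sup>3\<close> is a series in \<open>q\<^sup>3\<close>,
  so exponents of \<open>q\<close> congruent to \<open>2\<close> arise only from \<open>P\<^sub>n(2 - w) P\<^sub>m(2 + w)\<close> with \<open>n \<equiv> m \<equiv> 1\<close>. In
  that case \<open>P\<^bsub>3l+1\<^esub>(t) = (1 + t) P\<^sub>l(t\<^sup>3 - 3t)\<close> shows that the product is \<open>w\<^sup>2\<close> times a polynomial
  in \<open>w\<^sup>3\<close> modulo \<open>3\<close>, whence only \<open>a \<equiv> 1\<close> survives.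
\<close>

subsection \<open>The divisor sum for \<open>a = 1\<close>\<close>

text \<open>As a summand carries \<open>X^(r * sum_list ns)\<close>, tuples with an entry above
  \<open>N\<close> contribute nothing up to \<open>X^N\<close>; the others correspond to their sets
  of entries. This yields the subset sum of \<open>coeff_jacobi_product\<close>.\<close>

lemma gen_series_nth:
  assumes "r \<ge> 1" "n \<le> N"
  shows "gen_series a k r $ n =
    (\<Sum>S | S \<subseteq> {1..N} \<and> card S = a. \<Prod>m\<in>S. fps_X ^ (r * m) * one_minus_X_power_inverse m ^ k) $ n"
proof -
  let ?T = "{ns \<in> increasing_tuples a. set ns \<subseteq> {1..N}}"
  let ?F = "\<lambda>n. {ns. ns \<in> increasing_tuples a \<and> summand k r ns $ n \<noteq> 0}"
  let ?P = "\<lambda>S. \<Prod>m\<in>S. fps_X ^ (r * m) * one_minus_X_power_inverse m ^ k"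
  have sub: "?F n \<subseteq> {ns \<in> increasing_tuples a. sum_list ns \<le> n}" for n
  proof safe
    fix ns assume "summand k r ns $ n \<noteq> 0"
    then have "r * sum_list ns \<le> n"
      unfolding summand_def by (auto simp: fps_X_power_mult_nth not_less split: if_splits)
    moreover have "sum_list ns \<le> r * sum_list ns"
      using assms by simp
    ultimately show "sum_list ns \<le> n" by linarith
  qed
  have fin: "finite (?F n)" for n
    by (rule finite_subset[OF sub finite_tuples_bounded])
  have "(summand k r has_sum Abs_fps (\<lambda>n. \<Sum>ns\<in>?F n. summand k r ns $ n)) (increasing_tuples a)"
    by (rule has_sum_fpsI) (use fin in simp_all)
  then have "gen_series a k r $ n = (\<Sum>ns\<in>?F n. summand k r ns $ n)"
    by (simp add: gen_series_def infsumI)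
  also have "\<dots> = (\<Sum>ns\<in>?T. summand k r ns $ n)"
  proof (rule sum.mono_neutral_left)
    have "?T \<subseteq> {ns. set ns \<subseteq> {1..N} \<and> length ns = a}"
      by (auto simp: increasing_tuples_def)
    then show "finite ?T"
      by (rule finite_subset) (intro finite_lists_length_eq, simp)
    show "?F n \<subseteq> ?T"
    proof
      fix ns assume ns: "ns \<in> ?F n"
      then have "sum_list ns \<le> n" "ns \<in> increasing_tuples a" using sub by auto
      then show "ns \<in> ?T"
        using member_le_sum_list[of _ ns] assms by (fastforce simp: increasing_tuples_def)
    qed
  qed auto
  also have "\<dots> = (\<Sum>ns\<in>?T. ?P (set ns) $ n)"
  proof (rule sum.cong)
    fix ns assume "ns \<in> ?T"
    then have d: "distinct ns"
      using strict_sorted_iff by (auto simp: increasing_tuples_def)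
    then have "sum_list ns = \<Sum>(set ns)"
      using sum_list_distinct_conv_sum_set[of ns "\<lambda>x. x"] by simp
    then have "summand k r ns = ?P (set ns)"
      using d by (simp add: summand_def prod.distrib prod.distinct_set_conv_list
          power_sum sum_distrib_left)
    then show "summand k r ns $ n = ?P (set ns) $ n" by simp
  qed simp
  also have "\<dots> = (\<Sum>S | S \<subseteq> {1..N} \<and> card S = a. ?P S $ n)"
  proof (rule sum.reindex_bij_witness[of _ sorted_list_of_set set])
    fix ns assume "ns \<in> ?T"
    then have ns: "sorted_wrt (<) ns" "length ns = a" "set ns \<subseteq> {1..N}"
      by (auto simp: increasing_tuples_def)
    then show "sorted_list_of_set (set ns) = ns"
      by (metis sorted_list_of_set.idem_if_sorted_distinct strict_sorted_iff)
    show "set ns \<in> {S. S \<subseteq> {1..N} \<and> card S = a}"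
      using ns by (auto simp: distinct_card strict_sorted_iff)
  next
    fix S assume "S \<in> {S. S \<subseteq> {1..N} \<and> card S = a}"
    then have S: "S \<subseteq> {1..N}" "card S = a" "finite S"
      by (auto intro: finite_subset)
    then show "set (sorted_list_of_set S) = S" by simp
    show "sorted_list_of_set S \<in> ?T"
      using S by (auto simp: increasing_tuples_def)
  qed simp
  finally show ?thesis by (simp add: fps_sum_nth)
qed

text \<open>The negative binomial series: by Pascal's rule, multiplication by \<open>1 - X^m\<close>
  lowers \<open>k\<close> by one, down to the geometric series.\<close>

lemma one_minus_X_power_inverse_power:
  assumes "m \<ge> 1"
  shows "one_minus_X_power_inverse m ^ Suc k =
    Abs_fps (\<lambda>n. if m dvd n then int ((n div m + k) choose k) else 0)" (is "_ = ?g k")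
proof -
  let ?u = "1 - fps_X ^ m :: int fps"
  have step: "?u * ?g (Suc k) = ?g k" for k
  proof (rule fps_ext)
    fix n
    have "(?u * ?g (Suc k)) $ n = ?g (Suc k) $ n - (if n < m then 0 else ?g (Suc k) $ (n - m))"
      by (simp only: left_diff_distrib fps_sub_nth fps_X_power_mult_nth) simp
    also have "\<dots> = ?g k $ n"
    proof (cases "m dvd n")
      case True
      then obtain j where n: "n = m * j" by blast
      show ?thesis
      proof (cases j)
        case 0
        then show ?thesis using assms n by simp
      next
        case (Suc i)
        have "n - m = m * i" using n Suc by simp
        then show ?thesis using assms n Suc by simp
      qed
    next
      case False
      then show ?thesis using assms by (simp add: dvd_minus_self)
    qed
    finally show "(?u * ?g (Suc k)) $ n = ?g k $ n" .
  qed
  have base: "?u * ?g 0 = 1"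
  proof (rule fps_ext)
    fix n
    have "(?u * ?g 0) $ n = ?g 0 $ n - (if n < m then 0 else ?g 0 $ (n - m))"
      by (simp only: left_diff_distrib fps_sub_nth fps_X_power_mult_nth) simp
    then show "(?u * ?g 0) $ n = 1 $ n"
      using assms by (auto simp: dvd_minus_self dest: dvd_imp_le)
  qed
  have inv: "?u * one_minus_X_power_inverse m = 1"
    by (rule one_minus_X_power_inverse[OF assms])
  have eq: "x = one_minus_X_power_inverse m * y" if "?u * x = y" for x y
  proof -
    have "x = (?u * one_minus_X_power_inverse m) * x" by (simp add: inv)
    also have "\<dots> = one_minus_X_power_inverse m * y" by (simp add: that[symmetric] ac_simps)
    finally show ?thesis .
  qed
  show ?thesis
  proof (induction k)
    case 0
    show ?case using eq[OF base] by simp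
  next
    case (Suc k)
    then show ?case using eq[OF step[of k]] by simp
  qed
qed

lemma c_coeff_1:
  assumes "r \<ge> 1" "n \<ge> 1"
  shows "c_coeff 1 (Suc k) r (int n) = (\<Sum>d | d dvd n \<and> r \<le> d. int ((d - r + k) choose k))"
proof -
  have card1: "{S. S \<subseteq> {1..n} \<and> card S = 1} = (\<lambda>m. {m}) ` {1..n}"
    by (auto simp: card_Suc_eq)
  have "c_coeff 1 (Suc k) r (int n) = gen_series 1 (Suc k) r $ n"
    using assms by (simp add: c_coeff_def)
  also have "\<dots> = (\<Sum>m=1..n. (fps_X ^ (r * m) * one_minus_X_power_inverse m ^ Suc k) $ n)"
    unfolding gen_series_nth[OF assms(1) le_refl] card1
    by (subst sum.reindex) (simp_all add: fps_sum_nth del: power_Suc)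
  also have "\<dots> = (\<Sum>m=1..n. if m dvd n \<and> r \<le> n div m then int ((n div m - r + k) choose k) else 0)"
  proof (rule sum.cong)
    fix m assume m: "m \<in> {1..n}"
    have "(fps_X ^ (r * m) * one_minus_X_power_inverse m ^ Suc k) $ n =
       (if n < r * m then 0 else if m dvd n - r * m then int (((n - r * m) div m + k) choose k) else 0)"
      using m by (subst one_minus_X_power_inverse_power) (simp_all add: fps_X_power_mult_nth)
    moreover have "(n - r * m) div m = n div m - r" if "r * m \<le> n"
      using m that div_mult_self1[of m "n - r * m" r] by simp
    moreover have "m dvd n - r * m \<longleftrightarrow> m dvd n" if "r * m \<le> n"
      using that by (metis dvd_diffD dvd_diff_nat dvd_triv_right)
    moreover have "r * m \<le> n \<longleftrightarrow> r \<le> n div m"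
      using m by (simp add: less_eq_div_iff_mult_less_eq)
    ultimately show "(fps_X ^ (r * m) * one_minus_X_power_inverse m ^ Suc k) $ n =
        (if m dvd n \<and> r \<le> n div m then int ((n div m - r + k) choose k) else 0)"
      by (auto simp del: power_Suc)
  qed simp
  also have "\<dots> = (\<Sum>m | m dvd n \<and> r \<le> n div m. int ((n div m - r + k) choose k))"
    using assms by (intro sum.mono_neutral_cong_right) (auto dest: dvd_imp_le intro!: Nat.gr0I)
  \<comment> \<open>The index passes from the part \<open>m\<close> to the complementary divisor
    \<open>d = n div m\<close>.\<close>
  also have "\<dots> = (\<Sum>d | d dvd n \<and> r \<le> d. int ((d - r + k) choose k))"
    using assms by (intro sum.reindex_bij_witness[of _ "\<lambda>d. n div d" "\<lambda>m. n div m"]) auto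
  finally show ?thesis .
qed

section \<open>Triangular numbers modulo 7\<close>

text \<open>With \<open>g d = d(d+1)/2\<close>, twice the sum over \<open>d, 2d, 4d\<close> is
  \<open>7(3d^2 + d)\<close>. As \<open>m\<close> is odd, the divisors of \<open>4m\<close> split
  uniquely into such triples.\<close>

lemma c_coeff_1_3_1:
  fixes m :: nat
  assumes "odd m"
  shows "[c_coeff 1 3 1 (int (4 * m)) = 0] (mod 7)"
proof -
  have m: "m > 0" using assms by (cases m) auto
  define g where "g d = int (Suc d choose 2)" for d
  have fin: "finite {d. d dvd m}" using m by simp
  have D: "{d. d dvd 4 * m \<and> 1 \<le> d} =
      {d. d dvd m} \<union> (*) 2 ` {d. d dvd m} \<union> (*) 4 ` {d. d dvd m}" (is "?L = ?R")
  proof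
    show "?R \<subseteq> ?L"
      using m by (auto intro!: Nat.gr0I dest: dvd_0_left simp: mult_dvd_mono)
    show "?L \<subseteq> ?R"
    proof
      fix d assume "d \<in> ?L"
      then have "d dvd 4 * m" by simp
      then obtain x y where xy: "d = x * y" "x dvd 4" "y dvd m"
        by (metis division_decomp)
      have "x \<le> 4" using xy by (auto dest: dvd_imp_le)
      then have "x \<in> {0, 1, 2, 3, 4}" by auto
      with xy(2) have "x = 1 \<or> x = 2 \<or> x = 4" by auto
      then show "d \<in> ?R" using xy by auto
    qed
  qed
  have odd: "odd d" if "d dvd m" for d
    using assms that by (metis dvd_trans)
  have s: "c_coeff 1 3 1 (int (4 * m)) = (\<Sum>d | d dvd 4 * m \<and> 1 \<le> d. g d)"
    using m c_coeff_1[of 1 "4 * m" 2] by (simp add: g_def eval_nat_numeral)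
  also have "\<dots> = (\<Sum>d | d dvd m. g d) + (\<Sum>d | d dvd m. g (2 * d)) + (\<Sum>d | d dvd m. g (4 * d))"
  proof -
    have disj: "{d. d dvd m} \<inter> (*) 2 ` {d. d dvd m} = {}"
      "({d. d dvd m} \<union> (*) 2 ` {d. d dvd m}) \<inter> (*) 4 ` {d. d dvd m} = {}"
      using odd by (auto dest: odd) (metis odd even_mult_iff even_numeral)+
    show ?thesis
      unfolding D using fin disj by (simp add: sum.union_disjoint sum.reindex inj_on_def)
  qed
  also have "\<dots> = (\<Sum>d | d dvd m. g d + g (2 * d) + g (4 * d))"
    by (simp add: sum.distrib)
  finally have *: "c_coeff 1 3 1 (int (4 * m)) = (\<Sum>d | d dvd m. g d + g (2 * d) + g (4 * d))" .
  have "7 dvd g d + g (2 * d) + g (4 * d)" for d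
  proof -
    have g: "2 * g d = int d * (int d + 1)" for d
    proof -
      have "2 * (Suc d choose 2) = d * (d + 1)"
        by (simp add: choose_two)
      then show ?thesis unfolding g_def by (metis of_nat_mult of_nat_numeral of_nat_add of_nat_1)
    qed
    have "2 * (g d + g (2 * d) + g (4 * d)) = 7 * (3 * (int d)\<^sup>2 + int d)"
      by (simp only: distrib_left g) (simp add: power2_eq_square algebra_simps)
    then have "(7::int) dvd 2 * (g d + g (2 * d) + g (4 * d))" by simp
    then show ?thesis by presburger
  qed
  then show ?thesis unfolding * cong_0_iff by (intro dvd_sum) auto
qed

section \<open>Lucas' congruence and complementary divisors\<close>

text \<open>In Vandermonde's sum \<open>p choose j\<close> vanishes modulo \<open>p\<close> unless
  \<open>j\<close> is \<open>0\<close> or \<open>p\<close>; this is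
  \<open>(1 + x)^p = 1 + x^p\<close> read off coefficientwise.\<close>

lemma choose_add_prime_cong:
  assumes "prime p"
  shows "[(n + p) choose (k + p) = (n choose (k + p)) + (n choose k)] (mod p)"
    and "k < p \<Longrightarrow> [(n + p) choose k = n choose k] (mod p)"
proof -
  have p: "p > 0" using assms prime_gt_0_nat by blast
  have dvd: "p dvd p choose j" if "j \<noteq> 0" "j \<noteq> p" for j
  proof (cases "j < p")
    case True
    then show ?thesis using assms that p by (intro dvd_choose_prime) auto
  next
    case False
    then show ?thesis using that by (simp add: binomial_eq_0)
  qed
  have V: "(n + p) choose r = (\<Sum>j\<le>r. (p choose j) * (n choose (r - j)))" for r
    using vandermonde[of p n r] by (simp add: add.commute)
  have "[(\<Sum>j\<le>k + p. (p choose j) * (n choose (k + p - j))) =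
     (\<Sum>j\<le>k + p. if j = 0 then n choose (k + p) else if j = p then n choose k else 0)] (mod p)"
    using dvd by (intro cong_sum) (auto simp: cong_0_iff)
  also have "(\<Sum>j\<le>k + p. if j = 0 then n choose (k + p) else if j = p then n choose k else 0) =
      (\<Sum>j\<in>{0, p}. if j = 0 then n choose (k + p) else if j = p then n choose k else 0)"
    by (rule sum.mono_neutral_right) auto
  also have "\<dots> = (n choose (k + p)) + (n choose k)" using p by simp
  finally show "[(n + p) choose (k + p) = (n choose (k + p)) + (n choose k)] (mod p)"
    unfolding V .
  assume k: "k < p"
  have "[(\<Sum>j\<le>k. (p choose j) * (n choose (k - j))) =
     (\<Sum>j\<le>k. if j = 0 then n choose k else 0)] (mod p)"
    using dvd k by (intro cong_sum) (auto simp: cong_0_iff)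
  then show "[(n + p) choose k = n choose k] (mod p)"
    unfolding V by simp
qed

lemma choose_mult_prime_cong:
  assumes "prime p" "j < p"
  shows "[(q * p + s) choose j = s choose j] (mod p)"
proof (induction q)
  case (Suc q)
  show ?case
    using choose_add_prime_cong(2)[OF assms, of "q * p + s"] Suc
    by (simp add: add.commute add.left_commute) (metis cong_trans)
qed simp

text \<open>Lucas' congruence for a lower entry with leading digit 1. Here \<open>q\<close> may
  exceed \<open>p\<close>: each further \<open>p\<close> in the upper entry adds one more
  \<open>s choose j\<close>.\<close>

lemma choose_prime_add_cong:
  assumes "prime p" "j < p" "s < p"
  shows "[(q * p + s) choose (j + p) = q * (s choose j)] (mod p)"
proof (induction q)
  case 0
  then show ?case using assms by (simp add: binomial_eq_0)
next
  case (Suc q)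
  have "[(q * p + s + p) choose (j + p) = ((q * p + s) choose (j + p)) + ((q * p + s) choose j)] (mod p)"
    by (rule choose_add_prime_cong(1)[OF assms(1)])
  moreover have "[((q * p + s) choose (j + p)) + ((q * p + s) choose j) =
      q * (s choose j) + (s choose j)] (mod p)"
    by (intro cong_add Suc choose_mult_prime_cong assms)
  ultimately show ?case by (simp add: algebra_simps) (metis cong_trans)
qed

text \<open>Adding the sum over complementary divisors doubles it, and 2 is invertible modulo odd
  \<open>p\<close>. A divisor with \<open>d = e\<close> is thereby covered too.\<close>

lemma sum_divisors_cong_0:
  fixes g :: "nat \<Rightarrow> int"
  assumes "N > 0" "odd p" and g: "\<And>d e. d * e = N \<Longrightarrow> int p dvd g d + g e"
  shows "int p dvd (\<Sum>d | d dvd N. g d)"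
proof -
  have "(\<Sum>d | d dvd N. g d) = (\<Sum>d | d dvd N. g (N div d))"
    using assms(1) by (intro sum.reindex_bij_witness[of _ "\<lambda>d. N div d" "\<lambda>d. N div d"]) auto
  then have "2 * (\<Sum>d | d dvd N. g d) = (\<Sum>d | d dvd N. g d + g (N div d))"
    by (simp add: sum.distrib)
  also have "int p dvd \<dots>"
    using g by (intro dvd_sum) auto
  finally have "int p dvd 2 * (\<Sum>d | d dvd N. g d)" .
  moreover have "coprime (int p) 2" using assms(2) by simp
  ultimately show ?thesis using coprime_dvd_mult_right_iff by blast
qed

text \<open>If \<open>d * e\<close> is 1 modulo \<open>p\<close>, then \<open>d\<close> and
  \<open>e\<close> lie in the class of \<open>c\<close> together, because \<open>c^2 = 1\<close>.
  For \<open>d = c + pu\<close> and \<open>e = c + pv\<close> the equation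
  \<open>d * e = p^2 n + 1\<close> forces \<open>p\<close> to divide \<open>u + v\<close>.\<close>

lemma sum_divisors_residue_cong_0:
  fixes g :: "nat \<Rightarrow> int" and c \<kappa> :: int
  assumes p: "prime p" "odd p" and c: "c = 1 \<or> c = -1"
    and g: "\<And>d. \<not> p dvd d \<Longrightarrow>
      [g d = (if [int d = c] (mod int p) then \<kappa> * ((int d - c) div int p) else 0)] (mod int p)"
  shows "int p dvd (\<Sum>d | d dvd p\<^sup>2 * n + 1. g d)"
proof (rule sum_divisors_cong_0)
  fix d e assume de: "d * e = p\<^sup>2 * n + 1"
  have p0: "int p \<noteq> 0" using p by auto
  have cc: "c * c = 1" using c by auto
  have de': "int d * int e = (int p)\<^sup>2 * int n + 1"
    by (metis de of_nat_1 of_nat_add of_nat_mult of_nat_power)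
  have ndvd: "\<not> p dvd d" "\<not> p dvd e"
  proof -
    have "\<not> p dvd d * e"
    proof
      assume "p dvd d * e"
      moreover have "p dvd p\<^sup>2 * n" by (simp add: power2_eq_square)
      ultimately have "p dvd 1" unfolding de by (metis dvd_add_right_iff)
      then show False using p by simp
    qed
    then show "\<not> p dvd d" "\<not> p dvd e" by (meson dvd_mult dvd_mult2)+
  qed
  have residue: "[int y = c] (mod int p)"
    if "[int x = c] (mod int p)" "int x * int y = (int p)\<^sup>2 * int n + 1" for x y
  proof -
    have "[c * int y = int x * int y] (mod int p)"
      by (rule cong_scalar_right[OF cong_sym[OF that(1)]])
    moreover have "[int x * int y = 1] (mod int p)"
      unfolding that(2) by (simp add: cong_iff_dvd_diff power2_eq_square)
    ultimately have "[c * (c * int y) = c * 1] (mod int p)"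
      by (intro cong_scalar_left) (rule cong_trans)
    then show ?thesis using cc by (simp flip: mult.assoc)
  qed
  show "int p dvd g d + g e"
  proof (cases "[int d = c] (mod int p)")
    case True
    then have True': "[int e = c] (mod int p)" using residue de' by blast
    obtain u v where u: "int d - c = int p * u" and v: "int e - c = int p * v"
      using True True' unfolding cong_iff_dvd_diff dvd_def by blast
    have "(int p * u + c) * (int p * v + c) = (int p)\<^sup>2 * int n + 1"
      using de' u v by (metis diff_add_cancel)
    \<comment> \<open>Cancelling one \<open>p\<close> still leaves a multiple of \<open>p\<close> on
      the right: this is where the square in \<open>p^2 n\<close> matters.\<close>
    then have "int p * (int p * (u * v) + c * (u + v)) = int p * (int p * int n)"
      using cc by (simp add: algebra_simps power2_eq_square)
    then have "int p * (u * v) + c * (u + v) = int p * int n"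
      using p0 by simp
    then have "c * (u + v) = int p * (int n - u * v)"
      by (simp add: algebra_simps)
    then have "c * (c * (u + v)) = int p * (c * (int n - u * v))"
      by simp
    then have "u + v = int p * (c * (int n - u * v))"
      using cc by (simp flip: mult.assoc)
    then have "int p dvd \<kappa> * (u + v)" by simp
    moreover have "[g d + g e = \<kappa> * u + \<kappa> * v] (mod int p)"
      using g[OF ndvd(1)] g[OF ndvd(2)] True True' u v p0 by (intro cong_add) simp_all
    ultimately show ?thesis
      by (metis cong_dvd_iff distrib_left)
  next
    case False
    then have "\<not> [int e = c] (mod int p)"
      using residue de' by (metis mult.commute)
    with False have "[g d + g e = 0 + 0] (mod int p)"
      using g[OF ndvd(1)] g[OF ndvd(2)] by (intro cong_add) simp_all
    then show ?thesis by (simp add: cong_0_iff)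
  qed
qed (use p in auto)

lemma int_cong_iff_mod_nat:
  assumes "s < p"
  shows "[int d = int s] (mod int p) \<longleftrightarrow> d mod p = s"
  using assms by (simp add: cong_int_iff) (simp add: cong_def)

text \<open>For \<open>d = qp + s\<close> the upper entry has digits \<open>q + 1, s - 1\<close> and
  the lower one \<open>1, p - 2\<close>. Lucas leaves only \<open>s = p - 1\<close>, with value
  \<open>q + 1 = (d + 1)/p\<close>.\<close>

lemma cong_choose_r_eq_pred:
  assumes p: "prime p" "odd p" and d: "\<not> p dvd d"
  shows "[int ((d + p - 1) choose (2 * p - 2)) =
    (if [int d = -1] (mod int p) then 1 * ((int d - (-1)) div int p) else 0)] (mod int p)"
proof -
  have p2: "p > 2" using p prime_ge_2_nat[of p] by (cases "p = 2") auto
  define q s where "q = d div p" and "s = d mod p"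
  have ds: "d = q * p + s" by (simp add: q_def s_def)
  have s: "0 < s" "s < p" using d p2 by (auto simp: s_def dvd_eq_mod_eq_0)
  have "d + p - 1 = Suc q * p + (s - 1)" "2 * p - 2 = (p - 2) + p"
    using s p2 by (auto simp: ds)
  then have c: "[(d + p - 1) choose (2 * p - 2) = Suc q * ((s - 1) choose (p - 2))] (mod p)"
    using choose_prime_add_cong[OF p(1), of "p - 2" "s - 1" "Suc q"] s p2 by simp
  have m1: "[int d = -1] (mod int p) \<longleftrightarrow> s = p - 1"
  proof -
    have "[int d = -1] (mod int p) \<longleftrightarrow> [int d = int (p - 1)] (mod int p)"
    proof -
      have "int d - (-1) = (int d - int (p - 1)) + int p" using p2 by (simp add: of_nat_diff)
      then show ?thesis unfolding cong_iff_dvd_diff by (metis dvd_add_triv_right_iff)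
    qed
    then show ?thesis using int_cong_iff_mod_nat[of "p - 1" p d] p2 by (simp add: s_def)
  qed
  show ?thesis
  proof (cases "s = p - 1")
    case True
    then have "int d + 1 = int p * int (Suc q)"
      using p2 by (simp add: ds of_nat_diff algebra_simps)
    then have "(int d - (-1)) div int p = int (Suc q)"
      using p2 by simp
    moreover have "(s - 1) choose (p - 2) = 1" using True p2 by (simp add: numeral_2_eq_2)
    ultimately show ?thesis
      using c True by (simp add: m1 flip: cong_int_iff del: of_nat_Suc)
  next
    case False
    then have z: "(s - 1) choose (p - 2) = 0" using s by (intro binomial_eq_0) linarith
    show ?thesis using c False unfolding z by (simp add: m1 flip: cong_int_iff)
  qed
qed

text \<open>Subtracting 2 borrows a digit when \<open>s = 1\<close>: the upper digits become
  \<open>q, p - 1\<close> and the value is \<open>q(p - 1)\<close>. For larger \<open>s\<close> the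
  digit \<open>s - 2\<close> is below \<open>p - 2\<close>, so the value is 0.\<close>

lemma cong_choose_r_eq_prime:
  assumes p: "prime p" "odd p" and d: "\<not> p dvd d"
  shows "[int ((d + p - 2) choose (2 * p - 2)) =
    (if [int d = 1] (mod int p) then (int p - 1) * ((int d - 1) div int p) else 0)] (mod int p)"
proof -
  have p2: "p > 2" using p prime_ge_2_nat[of p] by (cases "p = 2") auto
  define q s where "q = d div p" and "s = d mod p"
  have ds: "d = q * p + s" by (simp add: q_def s_def)
  have s: "0 < s" "s < p" using d p2 by (auto simp: s_def dvd_eq_mod_eq_0)
  have k: "2 * p - 2 = (p - 2) + p" using p2 by simp
  have m1: "[int d = 1] (mod int p) \<longleftrightarrow> s = 1"
    using int_cong_iff_mod_nat[of 1 p d] p2 by (simp add: s_def)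
  show ?thesis
  proof (cases "s = 1")
    case True
    have "d + p - 2 = q * p + (p - 1)" using True p2 by (simp add: ds)
    then have "[(d + p - 2) choose (2 * p - 2) = q * ((p - 1) choose (p - 2))] (mod p)"
      unfolding k using choose_prime_add_cong[OF p(1), of "p - 2" "p - 1" q] p2 by simp
    moreover have "(p - 1) choose (p - 2) = p - 1"
      using binomial_symmetric[of "p - 2" "p - 1"] p2 by simp
    moreover have "(int d - 1) div int p = int q"
      using True p2 by (simp add: ds)
    ultimately show ?thesis
      using True p2 by (simp add: m1 of_nat_diff mult.commute flip: cong_int_iff)
  next
    case False
    then have "d + p - 2 = Suc q * p + (s - 2)" using s by (simp add: ds)
    then have "[(d + p - 2) choose (2 * p - 2) = Suc q * ((s - 2) choose (p - 2))] (mod p)"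
      unfolding k using choose_prime_add_cong[OF p(1), of "p - 2" "s - 2" "Suc q"] s p2 by simp
    moreover have "(s - 2) choose (p - 2) = 0" using s False by (intro binomial_eq_0) linarith
    ultimately show ?thesis using False by (simp add: m1 flip: cong_int_iff)
  qed
qed

lemma c_coeff_1_prime:
  assumes p: "prime p" "odd p"
  shows "[c_coeff 1 (2 * p - 1) (p - 1) (int (p\<^sup>2 * n + 1)) = 0] (mod int p)"
    and "[c_coeff 1 (2 * p - 1) p (int (p\<^sup>2 * n + 1)) = 0] (mod int p)"
proof -
  have p2: "p \<ge> 2" using p prime_ge_2_nat by blast
  have k: "2 * p - 1 = Suc (2 * p - 2)" using p2 by simp
  let ?N = "p\<^sup>2 * n + 1"
  \<comment> \<open>For \<open>d < p - 1\<close> the upper entry \<open>d + p - 1\<close> is below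
    \<open>2p - 2\<close>, so the missing divisors can be added with value 0.\<close>
  have "(\<Sum>d | d dvd ?N \<and> p - 1 \<le> d. int ((d - (p - 1) + (2 * p - 2)) choose (2 * p - 2))) =
      (\<Sum>d | d dvd ?N. int ((d + p - 1) choose (2 * p - 2)))"
  proof (rule sum.mono_neutral_cong_left)
    fix d assume "d \<in> {d. d dvd ?N \<and> p - 1 \<le> d}"
    then have "d - (p - 1) + (2 * p - 2) = d + p - 1" using p2 by auto
    then show "int ((d - (p - 1) + (2 * p - 2)) choose (2 * p - 2)) = int ((d + p - 1) choose (2 * p - 2))"
      by simp
  qed (use p2 in \<open>auto intro!: binomial_eq_0\<close>)
  then show "[c_coeff 1 (2 * p - 1) (p - 1) (int ?N) = 0] (mod int p)"
    using c_coeff_1[of "p - 1" ?N "2 * p - 2"] p2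
      sum_divisors_residue_cong_0[OF p _ cong_choose_r_eq_pred[OF p], of n]
    by (simp only: k cong_0_iff) simp
  have "(\<Sum>d | d dvd ?N \<and> p \<le> d. int ((d - p + (2 * p - 2)) choose (2 * p - 2))) =
      (\<Sum>d | d dvd ?N. int ((d + p - 2) choose (2 * p - 2)))"
  proof (rule sum.mono_neutral_cong_left)
    fix d assume "d \<in> {d. d dvd ?N \<and> p \<le> d}"
    then have "d - p + (2 * p - 2) = d + p - 2" using p2 by auto
    then show "int ((d - p + (2 * p - 2)) choose (2 * p - 2)) = int ((d + p - 2) choose (2 * p - 2))"
      by simp
  qed (use p2 in \<open>auto intro!: binomial_eq_0\<close>)
  then show "[c_coeff 1 (2 * p - 1) p (int ?N) = 0] (mod int p)"
    using c_coeff_1[of p ?N "2 * p - 2"] p2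
      sum_divisors_residue_cong_0[OF p _ cong_choose_r_eq_prime[OF p], of n]
    by (simp only: k cong_0_iff) simp
qed

subsection \<open>The finite Jacobi triple product\<close>

text \<open>Gaussian binomials, given by a Pascal rule instead of a quotient so that
  \<open>q\<close> can be any ring element, such as a constant polynomial over power series.\<close>

fun qbinomial :: "'a::comm_ring_1 \<Rightarrow> nat \<Rightarrow> nat \<Rightarrow> 'a" where
  "qbinomial q n 0 = 1"
| "qbinomial q 0 (Suc k) = 0"
| "qbinomial q (Suc n) (Suc k) = qbinomial q n k + q ^ Suc k * qbinomial q n (Suc k)"

definition qpoch :: "'a::comm_ring_1 \<Rightarrow> nat \<Rightarrow> 'a" where
  "qpoch q n = (\<Prod>i=1..n. 1 - q ^ i)"

lemma qpoch_0 [simp]: "qpoch q 0 = 1"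
  by (simp add: qpoch_def)

lemma qpoch_Suc: "qpoch q (Suc n) = qpoch q n * (1 - q ^ Suc n)"
  by (simp add: qpoch_def)

lemma qbinomial_eq_0: "n < k \<Longrightarrow> qbinomial q n k = 0"
  by (induction q n k rule: qbinomial.induct) auto

lemma qbinomial_self [simp]: "qbinomial q n n = 1"
  by (induction n) (auto simp: qbinomial_eq_0)

text \<open>The mirrored Pascal rule, with the power of \<open>q\<close> on the other term. Symmetry
  and the three-term relation come from playing the two rules against each other.\<close>

lemma qbinomial_Suc_Suc':
  "k \<le> n \<Longrightarrow> qbinomial q (Suc n) (Suc k) = q ^ (n - k) * qbinomial q n k + qbinomial q n (Suc k)"
proof (induction n arbitrary: k)
  case 0
  then show ?case by simp
next
  case (Suc m)
  show ?case
  proof (cases "k = Suc m")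
    case True
    then show ?thesis by (simp add: qbinomial_eq_0)
  next
    case False
    then have km: "k \<le> m" using Suc.prems by simp
    have 1: "qbinomial q (Suc m) (Suc k) = q ^ (m - k) * qbinomial q m k + qbinomial q m (Suc k)"
      by (rule Suc.IH[OF km])
    show ?thesis
    proof (cases k)
      case 0
      with 1 show ?thesis by (simp add: algebra_simps)
    next
      case k: (Suc j)
      have 2: "qbinomial q (Suc m) k = q ^ (m - j) * qbinomial q m j + qbinomial q m k"
        using Suc.IH[of j] km k by simp
      have 3: "qbinomial q (Suc m) k = qbinomial q m j + q ^ k * qbinomial q m k"
        using k by simp
      have 4: "qbinomial q (Suc m) (Suc k) = qbinomial q m k + q ^ Suc k * qbinomial q m (Suc k)"
        by simp
      have e2: "q ^ (m - j) * q ^ k = q ^ Suc k * q ^ (m - k)"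
        using km k by (simp flip: power_Suc power_add)
      have "qbinomial q (Suc (Suc m)) (Suc k)
          = qbinomial q (Suc m) k + q ^ Suc k * qbinomial q (Suc m) (Suc k)"
        by (simp only: qbinomial.simps)
      also have "\<dots> = q ^ (m - j) * qbinomial q m j + qbinomial q m k
          + q ^ Suc k * q ^ (m - k) * qbinomial q m k + q ^ Suc k * qbinomial q m (Suc k)"
        by (subst 1, subst 2) (simp add: algebra_simps)
      also have "\<dots> = q ^ (m - j) * qbinomial q (Suc m) k + qbinomial q (Suc m) (Suc k)"
        unfolding e2[symmetric] by (subst 3, subst 4) (simp add: algebra_simps)
      finally show ?thesis using k by simp
    qed
  qed
qed

lemma qbinomial_symmetric: "k \<le> n \<Longrightarrow> qbinomial q n (n - k) = qbinomial q n k"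
proof (induction n arbitrary: k)
  case 0
  then show ?case by simp
next
  case (Suc n)
  show ?case
  proof (cases k)
    case 0
    then show ?thesis by simp
  next
    case k: (Suc j)
    show ?thesis
    proof (cases "k = Suc n")
      case True
      then show ?thesis by simp
    next
      case False
      then have "j < n" using k Suc.prems by simp
      then obtain i where i: "n - j = Suc i" "n - Suc j = i" "i \<le> n" "n - i = Suc j"
        by (metis Suc_diff_Suc diff_diff_cancel diff_le_self less_imp_Suc_add less_or_eq_imp_le Suc_leI)
      have "qbinomial q n i = qbinomial q n (Suc j)" "qbinomial q n (Suc i) = qbinomial q n j"
        using Suc.IH[of "Suc j"] Suc.IH[of j] i \<open>j < n\<close> by auto
      then show ?thesis
        using k i qbinomial_Suc_Suc'[OF i(3), of q] by simp
    qed
  qed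
qed

text \<open>The quotient formula in multiplied-out form. The induction rests on
  \<open>1 - q^(n+1) = (1 - q^(j+1)) + q^(j+1) (1 - q^(n-j))\<close>.\<close>

lemma qbinomial_qpoch:
  "k \<le> n \<Longrightarrow> qbinomial q n k * qpoch q k * qpoch q (n - k) = qpoch q n"
proof (induction n arbitrary: k)
  case 0
  then show ?case by simp
next
  case (Suc n)
  show ?case
  proof (cases k)
    case 0
    then show ?thesis by simp
  next
    case k: (Suc j)
    show ?thesis
    proof (cases "j = n")
      case True
      then show ?thesis using k qbinomial_self[of q "Suc n"] by simp
    next
      case False
      with k Suc.prems have j: "Suc j \<le> n" by simp
      have s: "n - j = Suc (n - Suc j)" using j by simp
      have e: "q ^ n = q ^ j * q ^ (n - j)"
        using j by (simp flip: power_add)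
      have "qbinomial q (Suc n) (Suc j) * qpoch q (Suc j) * qpoch q (n - j)
        = (qbinomial q n j * qpoch q j * qpoch q (n - j)) * (1 - q ^ Suc j)
        + q ^ Suc j * (qbinomial q n (Suc j) * qpoch q (Suc j) * qpoch q (n - Suc j)) * (1 - q ^ (n - j))"
        by (simp add: s qpoch_Suc algebra_simps)
      also have "\<dots> = qpoch q n * (1 - q ^ Suc n)"
        using Suc.IH[of j] Suc.IH[of "Suc j"] j by (simp add: e algebra_simps)
      finally show ?thesis using k by (simp add: qpoch_Suc)
    qed
  qed
qed

text \<open>One Pascal step of each kind. The upper entry rises by two, as \<open>2N + 1\<close>
  does when the product gains a factor.\<close>

lemma qbinomial_three_term:
  assumes "k \<le> m"
  shows "qbinomial q (m + 2) (k + 2) =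
    (1 + q ^ (m + 1)) * qbinomial q m (k + 1) + q ^ (k + 2) * qbinomial q m (k + 2)
    + q ^ (m - k) * qbinomial q m k"
proof (cases "k = m")
  case True
  then show ?thesis by (simp add: qbinomial_eq_0)
next
  case False
  with assms have km: "Suc k \<le> m" by simp
  have e: "q ^ (m + 1) = q ^ (k + 2) * q ^ (m - Suc k)"
    using km by (simp flip: power_Suc power_add)
  have "qbinomial q (m + 2) (k + 2) =
      qbinomial q (Suc m) (Suc k) + q ^ (k + 2) * qbinomial q (Suc m) (Suc (Suc k))"
    by simp
  then show ?thesis
    using qbinomial_Suc_Suc'[OF km, of q] qbinomial_Suc_Suc'[OF assms, of q]
    by (simp only: e) (simp add: algebra_simps)
qed

section \<open>Expansion of the product in symmetric sums\<close>

text \<open>In terms of \<open>t = \<zeta> + \<zeta>\<^sup>-\<^sup>1\<close> this is \<open>\<zeta>\<^sup>-\<^sup>n + \<dots> + \<zeta>\<^sup>n\<close>.\<close>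

fun symsum :: "nat \<Rightarrow> 'a::comm_ring_1 \<Rightarrow> 'a" where
  "symsum 0 t = 1"
| "symsum (Suc 0) t = 1 + t"
| "symsum (Suc (Suc n)) t = t * symsum (Suc n) t - symsum n t"

text \<open>Multiplication by \<open>t\<close> takes \<open>symsum n\<close> to
  \<open>symsum (n+1) + symsum (n-1)\<close>, where the recursion run backwards gives
  \<open>symsum (-1) = -1\<close>; hence the entry \<open>- c 0\<close> at \<open>n = 0\<close>. The
  last two terms are the truncation error.\<close>

lemma mult_sum_symsum:
  fixes c :: "nat \<Rightarrow> 'a::comm_ring_1"
  shows "t * (\<Sum>n\<le>N. c n * symsum n t) =
    (\<Sum>n\<le>N. (c (Suc n) + (if n = 0 then - c 0 else c (n - 1))) * symsum n t)
    + c N * symsum (Suc N) t - c (Suc N) * symsum N t"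
  by (induction N) (simp_all add: algebra_simps)

text \<open>The exponent is \<open>n(n+1)/2\<close>. The value 0 beyond \<open>N\<close> lets the
  recurrence in \<open>N\<close> hold for every \<open>n\<close>.\<close>

definition jacobi_coeff :: "'a::comm_ring_1 \<Rightarrow> nat \<Rightarrow> nat \<Rightarrow> 'a" where
  "jacobi_coeff q N n =
     (if n \<le> N then (-1) ^ n * q ^ (\<Sum>{..n}) * qbinomial q (2 * N + 1) (N - n) else 0)"

text \<open>Comparison of the coefficients of \<open>symsum n\<close> after multiplication by
  \<open>1 + q^(2N+2) - t q^(N+1)\<close>. Inside the range this is
  \<open>qbinomial_three_term\<close>; near \<open>n = N\<close> some of its terms drop out.\<close>

lemma jacobi_coeff_Suc:
  "jacobi_coeff q (Suc N) n =
    (1 + q ^ (2 * Suc N)) * jacobi_coeff q N n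
    - q ^ Suc N * (jacobi_coeff q N (Suc n)
        + (if n = 0 then - jacobi_coeff q N 0 else jacobi_coeff q N (n - 1)))"
    (is "_ = ?rhs")
proof -
  consider "n > Suc N" | "n = Suc N" | "n = N" "n > 0" | "n = 0" "N = 0" | "n = 0" "N > 0" | "0 < n" "n < N"
    by linarith
  then show ?thesis
  proof cases
    case 1
    then show ?thesis by (auto simp: jacobi_coeff_def)
  next
    case 2
    then show ?thesis by (simp add: jacobi_coeff_def power_add)
  next
    case 3
    then obtain M where N: "N = Suc M" "n = Suc M" by (cases N) auto
    have "qbinomial q (2 * Suc N + 1) 1 =
        1 + q ^ (2 * Suc N) + q * qbinomial q (2 * N + 1) 1"
      using qbinomial_Suc_Suc'[of 0 "2 * N + 1" q] by (simp add: algebra_simps)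
    then show ?thesis
      unfolding jacobi_coeff_def N
      by (simp add: power_add algebra_simps del: qbinomial.simps(3))
  next
    case 4
    then show ?thesis
      by (simp add: jacobi_coeff_def numeral_eq_Suc algebra_simps)
  next
    case 5
    then obtain M where N: "N = Suc M" by (cases N) auto
    \<comment> \<open>At \<open>n = 0\<close> the left neighbour is
      \<open>- jacobi_coeff q N 0\<close>; equality of the two middle binomials turns it into the
      term the three-term relation asks for.\<close>
    have sym: "qbinomial q (2 * N + 1) (N + 1) = qbinomial q (2 * N + 1) N"
      using qbinomial_symmetric[of N "2 * N + 1" q] by simp
    have "qbinomial q (2 * N + 1 + 2) (M + 2) =
      (1 + q ^ (2 * Suc N)) * qbinomial q (2 * N + 1) N + q ^ Suc N * qbinomial q (2 * N + 1) N
      + q ^ (N + 2) * qbinomial q (2 * N + 1) (N - 1)"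
      using qbinomial_three_term[of M "2 * N + 1" q] sym
      by (simp add: N power_add eval_nat_numeral del: qbinomial.simps(3))
    moreover have "2 * N + 1 + 2 = 2 * Suc N + 1" "M + 2 = Suc N" using N by simp_all
    ultimately have *: "qbinomial q (2 * Suc N + 1) (Suc N) =
      (1 + q ^ (2 * Suc N)) * qbinomial q (2 * N + 1) N + q ^ Suc N * qbinomial q (2 * N + 1) N
      + q ^ (N + 2) * qbinomial q (2 * N + 1) (N - 1)" by metis
    have r: "?rhs = (1 + q ^ (2 * Suc N)) * qbinomial q (2 * N + 1) N
       - q ^ Suc N * (- (q * qbinomial q (2 * N + 1) (N - 1)) - qbinomial q (2 * N + 1) N)"
      using \<open>n = 0\<close> \<open>N > 0\<close> by (simp add: jacobi_coeff_def del: qbinomial.simps)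
    have l: "jacobi_coeff q (Suc N) n = qbinomial q (2 * Suc N + 1) (Suc N)"
      using \<open>n = 0\<close> by (simp add: jacobi_coeff_def del: qbinomial.simps)
    show ?thesis
      unfolding l r * by (simp add: algebra_simps del: qbinomial.simps)
  next
    case 6
    obtain j where n: "n = Suc j" using 6 by (cases n) auto
    obtain k where N: "N = Suc (n + k)" using 6 by (metis less_imp_Suc_add)
    have "qbinomial q (2 * N + 1 + 2) (k + 2) =
      (1 + q ^ (2 * N + 1 + 1)) * qbinomial q (2 * N + 1) (k + 1)
       + q ^ (k + 2) * qbinomial q (2 * N + 1) (k + 2)
      + q ^ (2 * N + 1 - k) * qbinomial q (2 * N + 1) k"
      using N by (intro qbinomial_three_term) simp
    moreover have "2 * N + 1 + 2 = 2 * Suc N + 1" "2 * N + 1 + 1 = 2 * Suc N"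
      "2 * N + 1 - k = Suc (Suc (N + n))"
      using N by simp_all
    ultimately have *: "qbinomial q (2 * Suc N + 1) (k + 2) =
      (1 + q ^ (2 * Suc N)) * qbinomial q (2 * N + 1) (k + 1)
       + q ^ (k + 2) * qbinomial q (2 * N + 1) (k + 2)
      + q ^ Suc (Suc (N + n)) * qbinomial q (2 * N + 1) k"
      by metis
    have l: "jacobi_coeff q (Suc N) n = (-1) ^ n * q ^ (\<Sum>{..n}) * qbinomial q (2 * Suc N + 1) (k + 2)"
      using N by (simp add: jacobi_coeff_def del: qbinomial.simps)
    have r0: "jacobi_coeff q N n = (-1) ^ n * q ^ (\<Sum>{..n}) * qbinomial q (2 * N + 1) (k + 1)"
      using N by (simp add: jacobi_coeff_def del: qbinomial.simps)
    have r1: "jacobi_coeff q N (Suc n) =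
        - ((-1) ^ n * q ^ (\<Sum>{..n}) * q ^ Suc n * qbinomial q (2 * N + 1) k)"
      using N by (simp add: jacobi_coeff_def power_add algebra_simps del: qbinomial.simps)
    have r2: "jacobi_coeff q N (n - 1) = (-1) ^ j * q ^ (\<Sum>{..j}) * qbinomial q (2 * N + 1) (k + 2)"
      using N n by (simp add: jacobi_coeff_def del: qbinomial.simps)
    have e1: "q ^ Suc (Suc (N + n)) = q ^ Suc N * q ^ Suc n"
      by (simp add: power_add)
    have e2: "q ^ (\<Sum>{..n}) * q ^ (k + 2) = q ^ Suc N * q ^ (\<Sum>{..j})"
      unfolding power_add[symmetric] using N n by (intro arg_cong[where f = "power q"]) simp
    have e3: "(-1) ^ n = - ((-1::'a) ^ j)"
      using n by simp
    have "jacobi_coeff q (Suc N) n = (1 + q ^ (2 * Suc N)) * jacobi_coeff q N n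
       - (-1) ^ j * (q ^ (\<Sum>{..n}) * q ^ (k + 2)) * qbinomial q (2 * N + 1) (k + 2)
       - q ^ Suc N * jacobi_coeff q N (Suc n)"
      unfolding l * r0 r1 e1 by (simp add: e3 algebra_simps del: qbinomial.simps power_Suc)
    then show ?thesis
      unfolding e2 using \<open>0 < n\<close> r2 by (simp add: algebra_simps del: qbinomial.simps power_Suc)
  qed
qed

text \<open>For \<open>t = z + 1/z\<close> a factor is \<open>(1 - z q^i) (1 - q^i / z)\<close>;
  written in \<open>t\<close>, the identity makes sense in every commutative ring.\<close>

theorem finite_jacobi_triple_product:
  fixes q t :: "'a::comm_ring_1"
  shows "(\<Prod>i=1..N. 1 - t * q ^ i + q ^ (2 * i)) = (\<Sum>n\<le>N. jacobi_coeff q N n * symsum n t)"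
proof (induction N)
  case 0
  then show ?case by (simp add: jacobi_coeff_def)
next
  case (Suc N)
  let ?c = "jacobi_coeff q N"
  let ?s = "\<lambda>c. \<Sum>n\<le>Suc N. c n * symsum n t"
  \<comment> \<open>These zeros extend the sum to \<open>Suc N\<close> and remove the truncation
    error in \<open>mult_sum_symsum\<close>.\<close>
  have z: "?c (Suc N) = 0" "?c (Suc (Suc N)) = 0"
    by (simp_all add: jacobi_coeff_def)
  have S: "(\<Sum>n\<le>N. ?c n * symsum n t) = ?s ?c"
    using z by simp
  have "(\<Prod>i=1..Suc N. 1 - t * q ^ i + q ^ (2 * i)) = (1 - t * q ^ Suc N + q ^ (2 * Suc N)) * ?s ?c"
    using Suc S by (simp add: mult.commute)
  also have "\<dots> = (1 + q ^ (2 * Suc N)) * ?s ?c - q ^ Suc N * (t * ?s ?c)"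
    by (simp only: algebra_simps)
  also have "t * ?s ?c = ?s (\<lambda>n. ?c (Suc n) + (if n = 0 then - ?c 0 else ?c (n - 1)))"
    unfolding mult_sum_symsum z by simp
  also have "(1 + q ^ (2 * Suc N)) * ?s ?c - q ^ Suc N * \<dots> = ?s (jacobi_coeff q (Suc N))"
    unfolding sum_distrib_left sum_subtractf[symmetric] jacobi_coeff_Suc[of q N]
    by (intro sum.cong refl) (simp only: algebra_simps)
  finally show ?case .
qed

subsection \<open>Coefficients modulo 3\<close>

lemma fps_X_power_dvd_nth:
  fixes f :: "'a::comm_ring_1 fps"
  assumes "fps_X ^ Suc N dvd f" "j \<le> N"
  shows "f $ j = 0"
  using assms by (auto elim!: dvdE simp: fps_X_power_mult_nth simp del: power_Suc)

lemma qpoch_X_nth_0: "qpoch fps_X n $ 0 = (1 :: 'a::comm_ring_1)"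
  by (induction n) (simp_all add: qpoch_Suc)

lemma qpoch_X_dvd_diff:
  "m \<le> n \<Longrightarrow> fps_X ^ Suc m dvd qpoch fps_X n - (qpoch fps_X m :: 'a::comm_ring_1 fps)"
proof (induction n rule: dec_induct)
  case (step n)
  have "fps_X ^ Suc m dvd (fps_X ^ Suc n :: 'a fps)"
    using step by (intro le_imp_power_dvd) simp
  then have "fps_X ^ Suc m dvd (qpoch fps_X n - (qpoch fps_X m :: 'a fps)) - qpoch fps_X n * fps_X ^ Suc n"
    by (intro dvd_diff[OF step.IH] dvd_mult)
  then show ?case by (simp add: qpoch_Suc algebra_simps)
qed simp

text \<open>Modulo \<open>X^(k+1)\<close> all Euler products involved agree with \<open>e\<close>,
  so the quotient formula reads \<open>b e^2 = e\<close> and the unit \<open>e\<close> cancels. The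
  factor \<open>X^(n(n+1)/2)\<close>, of exponent at least \<open>n\<close>, lifts the precision to
  \<open>X^(N+1)\<close>.\<close>

lemma qpoch_jacobi_coeff_X:
  fixes N n :: nat
  assumes "n \<le> N"
  shows "fps_X ^ Suc N dvd
    qpoch fps_X N * jacobi_coeff fps_X N n - (-1) ^ n * (fps_X :: 'a::comm_ring_1 fps) ^ (\<Sum>{..n})"
proof -
  let ?X = "fps_X :: 'a fps"
  define k where "k = N - n"
  define e b where "e = qpoch ?X k" and "b = qbinomial ?X (2 * N + 1) k"
  let ?d = "\<lambda>f. ?X ^ Suc k dvd f"
  have "b * e * qpoch ?X (2 * N + 1 - k) = qpoch ?X (2 * N + 1)"
    unfolding b_def e_def by (rule qbinomial_qpoch) (simp add: k_def)
  then have "e * (b * e - 1) =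
     (qpoch ?X (2 * N + 1) - e) - b * e * (qpoch ?X (2 * N + 1 - k) - e)"
    by (simp add: algebra_simps)
  moreover have "?d (qpoch ?X (2 * N + 1) - e)" "?d (qpoch ?X (2 * N + 1 - k) - e)"
    unfolding e_def by (intro qpoch_X_dvd_diff; simp add: k_def)+
  ultimately have "?d (e * (b * e - 1))" by (simp add: dvd_diff dvd_mult)
  moreover have "fps_right_inverse e 1 * (e * (b * e - 1)) = b * e - 1"
    using fps_right_inverse[of e 1] qpoch_X_nth_0[of k]
    by (metis e_def mult.commute mult.left_commute mult_1)
  ultimately have "?d (b * e - 1)" by (metis dvd_mult)
  moreover have "?d (b * (qpoch ?X N - e))"
    unfolding e_def by (intro dvd_mult qpoch_X_dvd_diff) (simp add: k_def)
  ultimately have "?d (b * (qpoch ?X N - e) + (b * e - 1))" by (rule dvd_add[rotated])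
  then have "?d (qpoch ?X N * b - 1)" by (simp add: algebra_simps)
  then have "?X ^ (\<Sum>{..n}) * ?X ^ Suc k dvd ?X ^ (\<Sum>{..n}) * (qpoch ?X N * b - 1)"
    by (rule mult_dvd_mono[OF dvd_refl])
  moreover have "n \<le> \<Sum>{..n}" by (rule member_le_sum) auto
  then have "?X ^ Suc N dvd ?X ^ (\<Sum>{..n}) * ?X ^ Suc k"
    unfolding power_add[symmetric] using assms by (intro le_imp_power_dvd) (simp add: k_def)
  ultimately have "?X ^ Suc N dvd (-1) ^ n * (?X ^ (\<Sum>{..n}) * (qpoch ?X N * b - 1))"
    by (meson dvd_mult dvd_trans)
  then show ?thesis
    using assms by (simp add: jacobi_coeff_def b_def k_def algebra_simps del: qbinomial.simps)
qed

section \<open>Residue classes of exponents modulo 3\<close>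

lemma sum_atMost_mod_3: "\<Sum>{..n} mod 3 = (if n mod 3 = 1 then 1 else 0 :: nat)"
proof (induction n)
  case (Suc n)
  have "\<Sum>{..Suc n} mod 3 = (\<Sum>{..n} mod 3 + Suc n mod 3) mod 3"
    by (simp add: mod_add_eq)
  moreover have "n mod 3 = 0 \<or> n mod 3 = 1 \<or> n mod 3 = 2" by linarith
  ultimately show ?case by (auto simp: Suc.IH mod_Suc simp del: sum.atMost_Suc)
qed simp

text \<open>Modulo 3, the sequence belongs to \<open>x^r\<close> times a series in
  \<open>x^3\<close> (for \<open>r < 3\<close>). Bare functions serve both polynomials in
  \<open>w\<close> and power series in \<open>X\<close>.\<close>

definition supp_mod_3 :: "nat \<Rightarrow> (nat \<Rightarrow> 'a::comm_ring_1) \<Rightarrow> bool" where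
  "supp_mod_3 r f \<longleftrightarrow> (\<forall>i. i mod 3 \<noteq> r mod 3 \<longrightarrow> 3 dvd f i)"

lemma supp_mod_3_convolution:
  assumes "supp_mod_3 r f" "supp_mod_3 s g"
  shows "supp_mod_3 (r + s) (\<lambda>n. \<Sum>i\<le>n. f i * g (n - i))"
  unfolding supp_mod_3_def
proof (intro allI impI dvd_sum)
  fix n i :: nat assume n: "n mod 3 \<noteq> (r + s) mod 3" "i \<in> {..n}"
  have "i mod 3 \<noteq> r mod 3 \<or> (n - i) mod 3 \<noteq> s mod 3"
    using n by (metis atMost_iff le_add_diff_inverse mod_add_eq)
  then show "3 dvd f i * g (n - i)"
    using assms by (auto simp: supp_mod_3_def)
qed

lemma supp_mod_3_poly:
  fixes p p' :: "'a::comm_ring_1 poly"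
  shows "supp_mod_3 r (coeff p) \<Longrightarrow> supp_mod_3 r (coeff p') \<Longrightarrow> supp_mod_3 r (coeff (p + p'))"
    and "supp_mod_3 r (coeff p) \<Longrightarrow> supp_mod_3 r (coeff p') \<Longrightarrow> supp_mod_3 r (coeff (p - p'))"
    and "supp_mod_3 r (coeff p) \<Longrightarrow> supp_mod_3 s (coeff p') \<Longrightarrow> supp_mod_3 (r + s) (coeff (p * p'))"
    and "supp_mod_3 r (coeff (3 * p))"
    and "supp_mod_3 0 (coeff (1 :: 'a poly))"
proof -
  show "supp_mod_3 r (coeff p) \<Longrightarrow> supp_mod_3 s (coeff p') \<Longrightarrow> supp_mod_3 (r + s) (coeff (p * p'))"
    using supp_mod_3_convolution[of r "coeff p" s "coeff p'"]
    by (simp add: coeff_mult[abs_def])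
  show "supp_mod_3 r (coeff (3 * p))"
  proof -
    have "3 * p = smult 3 p" by (simp add: numeral_poly)
    then show ?thesis by (simp add: supp_mod_3_def)
  qed
qed (auto simp: supp_mod_3_def coeff_1)

text \<open>For \<open>t = z + 1/z\<close> one has \<open>t^3 - 3t = z^3 + z^-3\<close>, and the
  powers of \<open>z\<close> from \<open>-(3l+1)\<close> to \<open>3l+1\<close> form
  \<open>2l+1\<close> blocks of three centred at powers of \<open>z^3\<close>.\<close>

lemma symsum_triple: "symsum (3 * l + 1) t = (1 + t) * symsum l (t ^ 3 - 3 * t)"
proof (induction l "t ^ 3 - 3 * t" rule: symsum.induct)
  case 1
  then show ?case by simp
next
  case 2
  then show ?case by (simp add: eval_nat_numeral algebra_simps)
next
  case (3 n)
  define a where "a = symsum (3 * n + 1) t"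
  \<comment> \<open>The recursion of \<open>symsum\<close> taken in steps of three.\<close>
  have "symsum (3 * Suc (Suc n) + 1) t = (t ^ 3 - 3 * t) * symsum (3 * Suc n + 1) t - a"
    unfolding a_def by (simp add: eval_nat_numeral algebra_simps)
  then show ?case
    using 3 by (simp add: a_def algebra_simps)
qed

text \<open>Modulo 3, \<open>t = 2 + v\<close> gives \<open>1 + t = v\<close> and
  \<open>t^3 - 3t = 2 + v^3\<close>, so \<open>symsum_triple\<close> yields \<open>v\<close> times a
  polynomial in \<open>v^3\<close>.\<close>

lemma symsum_supp_mod_3:
  fixes v :: "'a::comm_ring_1 poly"
  assumes v: "supp_mod_3 1 (coeff v)"
  shows "supp_mod_3 1 (coeff (symsum (3 * l + 1) (2 + v)))"
proof -
  have s0: "supp_mod_3 0 (coeff (symsum l t))" if "supp_mod_3 0 (coeff t)" for t :: "'a poly"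
    using that
    by (induction l t rule: symsum.induct)
       (use supp_mod_3_poly(3)[of 0 _ 0] in \<open>auto intro!: supp_mod_3_poly(1,2,5)\<close>)
  have "supp_mod_3 (1 + 1 + 1) (coeff (v * v * v))"
    by (intro supp_mod_3_poly v)
  then have v3: "supp_mod_3 0 (coeff (v * v * v))"
    by (simp add: supp_mod_3_def)
  have "(2 + v) ^ 3 - 3 * (2 + v) = 1 + 1 + v * v * v + 3 * (3 * v + 2 * v\<^sup>2)"
    by (simp add: eval_nat_numeral algebra_simps)
  also have "supp_mod_3 0 (coeff \<dots>)"
    by (intro supp_mod_3_poly v3)
  finally have "supp_mod_3 0 (coeff (symsum l ((2 + v) ^ 3 - 3 * (2 + v))))"
    by (rule s0)
  moreover have "1 + (2 + v) = 3 * 1 + v" by simp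
  then have "supp_mod_3 1 (coeff (1 + (2 + v)))"
    using supp_mod_3_poly(1)[OF supp_mod_3_poly(4) v, of 1] by simp
  ultimately show ?thesis
    unfolding symsum_triple using supp_mod_3_poly(3)[of 1 _ 0] by simp
qed

lemma Ints_coeff_mult:
  assumes "\<And>i. coeff p i \<in> \<int>" "\<And>i. coeff p' i \<in> \<int>"
  shows "coeff (p * p' :: 'a::comm_ring_1 poly) i \<in> \<int>"
  using assms by (simp add: coeff_mult Ints_sum Ints_mult)

text \<open>Over power series, coefficients in \<open>\<int>\<close> are constants, so they leave
  the exponents of \<open>X\<close> alone.\<close>

lemma symsum_Ints_coeff:
  fixes t :: "'a::comm_ring_1 poly"
  assumes "\<And>i. coeff t i \<in> \<int>"
  shows "coeff (symsum n t) i \<in> \<int>"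
proof -
  have "\<forall>i. coeff (symsum n t) i \<in> \<int>"
    using assms
    by (induction n t rule: symsum.induct) (auto simp: coeff_1 intro!: Ints_coeff_mult)
  then show ?thesis by simp
qed

lemma fps_nth_3_mult: "(3 * f) $ n = 3 * f $ n" for f :: "int fps"
  by (simp add: numeral_fps_const)

text \<open>Each factor satisfies \<open>(1 - x)^3 = 1 - x^3\<close> modulo 3.\<close>

lemma qpoch_X_cubed_supp_mod_3:
  "supp_mod_3 0 (fps_nth (qpoch (fps_X :: int fps) N ^ 3))"
proof (induction N)
  case 0
  then show ?case by (simp add: supp_mod_3_def)
next
  case (Suc N)
  have "(1 - fps_X ^ m :: int fps) ^ 3 = 1 - fps_X ^ (3 * m) - 3 * (fps_X ^ m - fps_X ^ (2 * m))" for m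
    by (simp add: eval_nat_numeral power_add algebra_simps)
  then have "supp_mod_3 0 (fps_nth ((1 - fps_X ^ m :: int fps) ^ 3))" for m
    by (auto simp: supp_mod_3_def fps_nth_3_mult simp del: right_diff_distrib_numeral)
  from supp_mod_3_convolution[OF Suc this[of "Suc N"]]
  show ?case by (simp add: qpoch_Suc power_mult_distrib fps_mult_nth atMost_atLeast0 del: power_Suc)
qed

text \<open>Modulo 3, \<open>f\<close> is a series in \<open>X^3\<close> with constant term 1.
  Multiplication by it keeps residue classes of exponents apart and can be undone within each
  class.\<close>

lemma fps_mult_mod_3_cancel:
  fixes f g :: "int fps"
  assumes f0: "f $ 0 = 1" and f: "supp_mod_3 0 (fps_nth f)"
    and fg: "\<And>j. j \<le> N \<Longrightarrow> j mod 3 = r \<Longrightarrow> 3 dvd (f * g) $ j"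
    and "j \<le> N" "j mod 3 = r"
  shows "3 dvd g $ j"
  using \<open>j \<le> N\<close> \<open>j mod 3 = r\<close>
proof (induction j rule: less_induct)
  case (less j)
  have "(f * g) $ j = g $ j + (\<Sum>i=1..j. f $ i * g $ (j - i))"
    by (simp add: fps_mult_nth sum.atLeast_Suc_atMost f0)
  moreover have "3 dvd (\<Sum>i=1..j. f $ i * g $ (j - i))"
  proof (rule dvd_sum)
    fix i assume i: "i \<in> {1..j}"
    show "3 dvd f $ i * g $ (j - i)"
    proof (cases "i mod 3 = 0")
      case True
      then have "(j - i) mod 3 = r"
        using less.prems i mod_add_right_eq[of "j - i" i 3] by simp
      then have "3 dvd g $ (j - i)" using less i by auto
      then show ?thesis by simp
    next
      case False
      then show ?thesis using f by (simp add: supp_mod_3_def)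
    qed
  qed
  ultimately show ?case using fg[OF less.prems] by (simp add: dvd_add_left_iff)
qed

section \<open>Extraction of powers of \<open>w\<close>\<close>

lemma qbinomial_const_poly: "qbinomial [:x:] n k = [:qbinomial x n k:]"
  by (induction x n k rule: qbinomial.induct)
     (simp_all add: poly_const_pow one_pCons del: power_Suc)

lemma minus_one_power_const_poly: "(-1) ^ n = [:(-1) ^ n :: 'a::comm_ring_1:]"
  by (induction n) (simp_all add: one_pCons)

lemma jacobi_coeff_const_poly: "jacobi_coeff [:x:] N n = [:jacobi_coeff x N n:]"
  by (simp add: jacobi_coeff_def qbinomial_const_poly poly_const_pow minus_one_power_const_poly
      del: qbinomial.simps)

lemma prod_monom: "(\<Prod>i\<in>A. monom (f i) (g i)) = monom (\<Prod>i\<in>A. f i) (\<Sum>i\<in>A. g i)"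
  by (induction A rule: infinite_finite_induct) (simp_all add: mult_monom)

text \<open>Up to the factor \<open>\<Prod>(1 - X\<^sup>i)\<^sup>4\<close>, the truncation of the generating series for \<open>k = 4\<close>, \<open>r = 2\<close>
  is a coefficient of a product of two triple products, since
  \<open>x\<^sup>2 / (1 - x)\<^sup>4\<close> is the square of \<open>x / (1 - x)\<^sup>2\<close>.\<close>

lemma coeff_jacobi_product:
  defines "w \<equiv> [:0, 1:] :: int fps poly" and "Q \<equiv> [:fps_X:] :: int fps poly"
  shows "coeff ((\<Prod>i=1..N. 1 - (2 + - w) * Q ^ i + Q ^ (2 * i)) *
        (\<Prod>i=1..N. 1 - (2 + w) * Q ^ i + Q ^ (2 * i))) (2 * a) =
    (-1) ^ a * qpoch fps_X N ^ 4 *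
    (\<Sum>S | S \<subseteq> {1..N} \<and> card S = a. \<Prod>m\<in>S. fps_X ^ (2 * m) * one_minus_X_power_inverse m ^ 4)"
proof -
  let ?X = "fps_X :: int fps"
  let ?I = one_minus_X_power_inverse
  \<comment> \<open>The factors are \<open>(1 - y)^2 + w y\<close> and
    \<open>(1 - y)^2 - w y\<close>, with product \<open>(1 - y)^4 - w^2 y^2\<close>.\<close>
  have fac: "(1 - (2 + - w) * Q ^ i + Q ^ (2 * i)) * (1 - (2 + w) * Q ^ i + Q ^ (2 * i))
      = monom (- (?X ^ (2 * i))) 2 + monom ((1 - ?X ^ i) ^ 4) 0" for i
  proof -
    have "(1 - (2 + - w) * y + y * y) * (1 - (2 + w) * y + y * y) = - (w * w * (y * y)) + (1 - y) ^ 4" for y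
      by (simp add: eval_nat_numeral algebra_simps)
    from this[of "Q ^ i"] have "(1 - (2 + - w) * Q ^ i + Q ^ (2 * i)) * (1 - (2 + w) * Q ^ i + Q ^ (2 * i))
      = - (w * w * (Q ^ (2 * i))) + (1 - Q ^ i) ^ 4"
      by (simp add: mult_2 power_add)
    also have "- (w * w * (Q ^ (2 * i))) = monom (- (?X ^ (2 * i))) 2"
      by (simp add: w_def Q_def poly_const_pow monom_altdef eval_nat_numeral)
    also have "(1 - Q ^ i) ^ 4 = monom ((1 - ?X ^ i) ^ 4) 0"
      by (simp add: Q_def poly_const_pow monom_0 one_pCons)
    finally show ?thesis .
  qed
  \<comment> \<open>Completing the product over the complement of \<open>S\<close> to
    \<open>qpoch^4\<close> is paid for by the inverses with \<open>m\<close> in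
    \<open>S\<close>.\<close>
  have summand: "(\<Prod>m\<in>S. - (?X ^ (2 * m))) * (\<Prod>m\<in>{1..N} - S. (1 - ?X ^ m) ^ 4) =
      (-1) ^ card S * qpoch ?X N ^ 4 * (\<Prod>m\<in>S. ?X ^ (2 * m) * ?I m ^ 4)"
    if S: "S \<subseteq> {1..N}" for S
  proof -
    have "(\<Prod>m\<in>S. (1 - ?X ^ m) ^ 4 * ?I m ^ 4) = 1"
      using S one_minus_X_power_inverse
      by (intro prod.neutral) (auto simp flip: power_mult_distrib)
    then have 1: "(\<Prod>m\<in>S. (1 - ?X ^ m) ^ 4) * (\<Prod>m\<in>S. ?I m ^ 4) = 1"
      by (simp add: prod.distrib)
    have "qpoch ?X N ^ 4 = (\<Prod>m\<in>{1..N} - S. (1 - ?X ^ m) ^ 4) * (\<Prod>m\<in>S. (1 - ?X ^ m) ^ 4)"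
      using prod.subset_diff[OF S, of "\<lambda>m. (1 - ?X ^ m) ^ 4"]
      by (simp add: qpoch_def prod_power_distrib)
    then have "qpoch ?X N ^ 4 * (\<Prod>m\<in>S. ?X ^ (2 * m) * ?I m ^ 4) =
      (\<Prod>m\<in>{1..N} - S. (1 - ?X ^ m) ^ 4) * (\<Prod>m\<in>S. ?X ^ (2 * m)) *
      ((\<Prod>m\<in>S. (1 - ?X ^ m) ^ 4) * (\<Prod>m\<in>S. ?I m ^ 4))"
      by (simp add: prod.distrib ac_simps)
    moreover have "(\<Prod>m\<in>S. - (?X ^ (2 * m))) = (-1) ^ card S * (\<Prod>m\<in>S. ?X ^ (2 * m))"
      by (simp add: prod_uminus)
    ultimately show ?thesis unfolding 1 by (simp only: mult_1_left ac_simps)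
  qed
  have "(\<Prod>i=1..N. 1 - (2 + - w) * Q ^ i + Q ^ (2 * i)) * (\<Prod>i=1..N. 1 - (2 + w) * Q ^ i + Q ^ (2 * i))
      = (\<Sum>S\<in>Pow {1..N}. monom ((\<Prod>m\<in>S. - (?X ^ (2 * m))) * (\<Prod>m\<in>{1..N} - S. (1 - ?X ^ m) ^ 4)) (2 * card S))"
    unfolding prod.distrib[symmetric] fac
    by (subst prod_add) (simp_all add: prod_monom mult_monom mult.commute[of _ 2])
  also have "coeff \<dots> (2 * a) = (\<Sum>S\<in>Pow {1..N}. if card S = a then
      (-1) ^ a * qpoch ?X N ^ 4 * (\<Prod>m\<in>S. ?X ^ (2 * m) * ?I m ^ 4) else 0)"
    unfolding coeff_sum by (intro sum.cong refl) (use summand in auto)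
  also have "\<dots> = (\<Sum>S | S \<subseteq> {1..N} \<and> card S = a.
      (-1) ^ a * qpoch ?X N ^ 4 * (\<Prod>m\<in>S. ?X ^ (2 * m) * ?I m ^ 4))"
    by (intro sum.mono_neutral_cong_right) auto
  finally show ?thesis by (simp add: sum_distrib_left)
qed

text \<open>Unless \<open>n\<close> and \<open>m\<close> are both 1 modulo 3, the triangular
  exponents add up to 0 or 1 modulo 3, and the constant \<open>\<kappa>\<close> cannot move them to
  \<open>j\<close>.\<close>

lemma theta_product_nth_dvd:
  fixes \<kappa> :: "int fps"
  assumes "\<kappa> \<in> \<int>" "n mod 3 = 1 \<Longrightarrow> m mod 3 = 1 \<Longrightarrow> 3 dvd \<kappa>" and "j mod 3 = 2"
  shows "3 dvd ((-1) ^ n * fps_X ^ (\<Sum>{..n}) * ((-1) ^ m * fps_X ^ (\<Sum>{..m})) * \<kappa>) $ j"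
proof (cases "n mod 3 = 1 \<and> m mod 3 = 1")
  case True
  then obtain \<mu> where "\<kappa> = 3 * \<mu>" using assms by auto
  then have *: "(-1) ^ n * fps_X ^ (\<Sum>{..n}) * ((-1) ^ m * fps_X ^ (\<Sum>{..m})) * \<kappa> =
      3 * ((-1) ^ n * fps_X ^ (\<Sum>{..n}) * ((-1) ^ m * fps_X ^ (\<Sum>{..m})) * \<mu>)"
    by (simp add: ac_simps)
  show ?thesis unfolding * fps_nth_3_mult by simp
next
  case False
  obtain k where "\<kappa> = of_int k" using assms(1) by (auto elim: Ints_cases)
  then have k: "\<kappa> = fps_const k" using fps_of_int[of k, where 'a = int] by (simp del: fps_of_int)
  have "(\<Sum>{..n} + \<Sum>{..m}) mod 3 = (\<Sum>{..n} mod 3 + \<Sum>{..m} mod 3) mod 3"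
    by (simp add: mod_add_eq)
  also have "\<dots> \<noteq> 2" using False by (auto simp: sum_atMost_mod_3)
  finally have "\<Sum>{..n} + \<Sum>{..m} \<noteq> j" using assms(3) by auto
  moreover have "(-1) ^ n * fps_X ^ (\<Sum>{..n}) * ((-1) ^ m * fps_X ^ (\<Sum>{..m})) * \<kappa> =
     fps_const ((-1) ^ (n + m) * k) * fps_X ^ (\<Sum>{..n} + \<Sum>{..m})"
    by (simp add: k power_add ac_simps flip: fps_const_mult fps_const_power fps_const_neg)
  ultimately show ?thesis by simp
qed

theorem gen_series_4_2_mod_3:
  assumes "j mod 3 = 2" "a mod 3 \<noteq> 1"
  shows "3 dvd gen_series a 4 2 $ j"
proof -
  define w Q where "w = ([:0, 1:] :: int fps poly)" and "Q = ([:fps_X:] :: int fps poly)"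
  let ?X = "fps_X :: int fps"
  let ?E = "qpoch ?X j"
  define G where "G = (\<Sum>S | S \<subseteq> {1..j} \<and> card S = a. \<Prod>m\<in>S. ?X ^ (2 * m) * one_minus_X_power_inverse m ^ 4)"
  define \<alpha> where "\<alpha> n = ?E * jacobi_coeff ?X j n" for n
  define \<beta> where "\<beta> n = (-1) ^ n * ?X ^ (\<Sum>{..n})" for n
  define \<kappa> where "\<kappa> n m = coeff (symsum n (2 + - w) * symsum m (2 + w)) (2 * a)" for n m
  have w: "supp_mod_3 1 (coeff w)" "supp_mod_3 1 (coeff (- w))"
    by (auto simp: w_def supp_mod_3_def coeff_pCons split: nat.splits)
  have "coeff (2 + - w) i \<in> \<int>" "coeff (2 + w) i \<in> \<int>" for i
    by (auto simp: w_def coeff_pCons numeral_poly split: nat.splits)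
  then have \<kappa>_Ints: "\<kappa> n m \<in> \<int>" for n m
    unfolding \<kappa>_def by (intro Ints_coeff_mult symsum_Ints_coeff)
  have \<kappa>_dvd: "3 dvd \<kappa> n m" if "n mod 3 = 1" "m mod 3 = 1" for n m
  proof -
    have nm: "n = 3 * (n div 3) + 1" "m = 3 * (m div 3) + 1"
      using that by presburger+
    have "supp_mod_3 (1 + 1) (coeff (symsum n (2 + - w) * symsum m (2 + w)))"
      by (subst nm(1), subst nm(2)) (intro supp_mod_3_poly(3) symsum_supp_mod_3 w)
    \<comment> \<open>\<open>2 * a\<close> is 2 modulo 3 exactly for \<open>a\<close> in the
      excluded class 1.\<close>
    moreover have "2 * a mod 3 \<noteq> (1 + 1) mod 3" using assms(2) by presburger
    ultimately show ?thesis by (simp add: supp_mod_3_def \<kappa>_def)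
  qed
  have J: "[:?E:] * (\<Prod>i=1..j. 1 - t * Q ^ i + Q ^ (2 * i)) = (\<Sum>n\<le>j. smult (\<alpha> n) (symsum n t))" for t
    unfolding finite_jacobi_triple_product sum_distrib_left \<alpha>_def Q_def jacobi_coeff_const_poly
    by (simp add: mult.commute)
  \<comment> \<open>Two factors \<open>?E\<close> for the triple products and \<open>?E^4\<close>
    from \<open>coeff_jacobi_product\<close> make a sixth power, a series in \<open>X^3\<close>
    modulo 3, which cancels.\<close>
  have cancel: "3 dvd G $ i" if "i \<le> j" "i mod 3 = 2" for i
  proof (rule fps_mult_mod_3_cancel[where f = "(?E ^ 3) * (?E ^ 3)" and N = j and r = 2])
    show "(?E ^ 3 * ?E ^ 3) $ 0 = 1" by (simp add: qpoch_X_nth_0 eval_nat_numeral)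
    show "supp_mod_3 0 (fps_nth (?E ^ 3 * ?E ^ 3))"
      using supp_mod_3_convolution[OF qpoch_X_cubed_supp_mod_3 qpoch_X_cubed_supp_mod_3, of j j]
      by (simp only: fps_mult_nth[abs_def] atMost_atLeast0 add_0)
    fix i assume i: "i \<le> j" "i mod 3 = 2"
    have "[:?E:] * [:?E:] * ((\<Prod>i=1..j. 1 - (2 + - w) * Q ^ i + Q ^ (2 * i)) *
        (\<Prod>i=1..j. 1 - (2 + w) * Q ^ i + Q ^ (2 * i))) =
      ([:?E:] * (\<Prod>i=1..j. 1 - (2 + - w) * Q ^ i + Q ^ (2 * i))) *
      ([:?E:] * (\<Prod>i=1..j. 1 - (2 + w) * Q ^ i + Q ^ (2 * i)))" (is "_ = ?r")
      by (simp only: ac_simps)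
    also have "?r = (\<Sum>n\<le>j. \<Sum>m\<le>j. smult (\<alpha> n * \<alpha> m) (symsum n (2 + - w) * symsum m (2 + w)))"
      unfolding J sum_product by (intro sum.cong refl) (simp add: mult.commute)
    finally have "coeff ([:?E * ?E:] * ((\<Prod>i=1..j. 1 - (2 + - w) * Q ^ i + Q ^ (2 * i)) *
        (\<Prod>i=1..j. 1 - (2 + w) * Q ^ i + Q ^ (2 * i)))) (2 * a) = (\<Sum>n\<le>j. \<Sum>m\<le>j. \<alpha> n * \<alpha> m * \<kappa> n m)"
      by (simp add: coeff_sum \<kappa>_def)
    then have "?E * ?E * ((-1) ^ a * ?E ^ 4 * G) = (\<Sum>n\<le>j. \<Sum>m\<le>j. \<alpha> n * \<alpha> m * \<kappa> n m)"
      using coeff_jacobi_product[of j a] by (simp add: G_def w_def Q_def)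
    then have "(-1) ^ a * (?E ^ 3 * ?E ^ 3 * G) = (\<Sum>n\<le>j. \<Sum>m\<le>j. \<alpha> n * \<alpha> m * \<kappa> n m)"
      by (simp add: eval_nat_numeral ac_simps)
    moreover have "3 dvd (\<Sum>n\<le>j. \<Sum>m\<le>j. \<alpha> n * \<alpha> m * \<kappa> n m) $ i"
      unfolding fps_sum_nth
    proof (intro dvd_sum)
      fix n m assume nm: "n \<in> {..j}" "m \<in> {..j}"
      \<comment> \<open>Replacing \<open>\<alpha>\<close> by \<open>\<beta>\<close> in one factor at
        a time turns Jacobi coefficients into theta terms up to \<open>X^j\<close>.\<close>
      have "?X ^ Suc j dvd (\<alpha> n - \<beta> n) * (\<alpha> m * \<kappa> n m) + (\<alpha> m - \<beta> m) * (\<beta> n * \<kappa> n m)"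
        using nm unfolding \<alpha>_def \<beta>_def by (intro dvd_add dvd_mult2 qpoch_jacobi_coeff_X) auto
      then have "?X ^ Suc j dvd \<alpha> n * \<alpha> m * \<kappa> n m - \<beta> n * \<beta> m * \<kappa> n m"
        by (simp add: algebra_simps)
      from fps_X_power_dvd_nth[OF this i(1)]
      have "(\<alpha> n * \<alpha> m * \<kappa> n m) $ i = (\<beta> n * \<beta> m * \<kappa> n m) $ i" by simp
      also have "3 dvd \<dots>"
        unfolding \<beta>_def using theta_product_nth_dvd[OF \<kappa>_Ints \<kappa>_dvd i(2)] .
      finally show "3 dvd (\<alpha> n * \<alpha> m * \<kappa> n m) $ i" .
    qed
    ultimately have "3 dvd ((-1) ^ a * (?E ^ 3 * ?E ^ 3 * G)) $ i" by simp
    then show "3 dvd (?E ^ 3 * ?E ^ 3 * G) $ i"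
      by (cases "even a") simp_all
  qed (use that in auto)
  show ?thesis
    using cancel[of j] assms gen_series_nth[of 2 j j a 4] by (simp add: G_def)
qed

section \<open>The three congruences for integer arguments\<close>

theorem theorem1p3:
  shows "(\<forall>n::int. n \<ge> 1 \<longrightarrow> [c_coeff 1 3 1 (8 * n - 4) = 0] (mod 7)) \<and>
    (\<forall>(a::nat) (n::int). a \<ge> 1 \<and> n \<ge> 1 \<longrightarrow>
       [c_coeff (3 * a) 4 2 (3 * n - 1) = 0] (mod 3) \<and>
       [c_coeff (3 * a - 1) 4 2 (3 * n - 1) = 0] (mod 3)) \<and>
    (\<forall>(n::int) (p::nat). prime p \<and> odd p \<longrightarrow>
       [c_coeff 1 (2 * p - 1) (p - 1) ((int p)\<^sup>2 * n + 1) = 0] (mod int p) \<and>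
       [c_coeff 1 (2 * p - 1) p ((int p)\<^sup>2 * n + 1) = 0] (mod int p))"
proof (intro conjI allI impI)
  fix n :: int assume n: "n \<ge> 1"
  define m where "m = nat (2 * n - 1)"
  have "odd m" "8 * n - 4 = int (4 * m)"
    using n by (auto simp: m_def even_nat_iff)
  then show "[c_coeff 1 3 1 (8 * n - 4) = 0] (mod 7)"
    using c_coeff_1_3_1 by metis
next
  fix a :: nat and n :: int assume "a \<ge> 1 \<and> n \<ge> 1"
  then have a: "a \<ge> 1" and n: "n \<ge> 1" by auto
  define j where "j = nat (3 * n - 1)"
  have "int j = 3 * (n - 1) + 2" using n by (simp add: j_def)
  then have j: "j mod 3 = 2" by presburger
  have c: "c_coeff b 4 2 (3 * n - 1) = gen_series b 4 2 $ j" for b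
    using n by (simp add: c_coeff_def j_def)
  show "[c_coeff (3 * a) 4 2 (3 * n - 1) = 0] (mod 3)"
    unfolding c cong_0_iff by (intro gen_series_4_2_mod_3 j) simp
  obtain b where "a = Suc b" using a by (cases a) auto
  then have "3 * a - 1 = 2 + 3 * b" by simp
  then have "(3 * a - 1) mod 3 \<noteq> 1" by presburger
  then show "[c_coeff (3 * a - 1) 4 2 (3 * n - 1) = 0] (mod 3)"
    unfolding c cong_0_iff by (intro gen_series_4_2_mod_3 j)
next
  fix n :: int and p :: nat assume p: "prime p \<and> odd p"
  \<comment> \<open>For \<open>n < 0\<close> the argument is at most 0 and the convention gives 0;
    \<open>n = 0\<close> falls under the divisor sum at 1.\<close>
  have neg: "c_coeff a k r ((int p)\<^sup>2 * n + 1) = 0" if "n < 0" for a k r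
  proof -
    have "(int p)\<^sup>2 > 0" using p prime_gt_0_nat[of p] by simp
    then have "(int p)\<^sup>2 * n < 0" using that by (rule mult_pos_neg)
    then show ?thesis by (simp add: c_coeff_def)
  qed
  have pos: "(int p)\<^sup>2 * n + 1 = int (p\<^sup>2 * nat n + 1)" if "\<not> n < 0"
    using that by simp
  show "[c_coeff 1 (2 * p - 1) (p - 1) ((int p)\<^sup>2 * n + 1) = 0] (mod int p)"
  proof (cases "n < 0")
    case True
    show ?thesis unfolding neg[OF True] by (rule cong_refl)
  next
    case False
    show ?thesis unfolding pos[OF False] using p by (intro c_coeff_1_prime(1)) auto
  qed
  show "[c_coeff 1 (2 * p - 1) p ((int p)\<^sup>2 * n + 1) = 0] (mod int p)"
  proof (cases "n < 0")
    case True
    show ?thesis unfolding neg[OF True] by (rule cong_refl)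
  next
    case False
    show ?thesis unfolding pos[OF False] using p by (intro c_coeff_1_prime(2)) auto
  qed
qed

end
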